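(* Every finite dimensional complex Banach space has the $\mathbf{L}_{p,p}$-nu.
   Context: For a Banach space $X$: $\Pi(X)=\{(x,x^* )\in S_X\times S_{X^*}: x^*(x)=1\}$; for $T\in\mathcal{L}(X)$ (bounded linear operators on $X$), $v(T)=\sup\{|x^*(Tx)|:(x,x^* )\in\Pi(X)\}$. $X$ has the $\mathbf{L}_{p,p}$-nu if for every $\varepsilon>0$ and $(x,x^* )\in\Pi(X)$ there is $\eta(\varepsilon,(x,x^* ))>0$ such that whenever $T\in\mathcal{L}(X)$ with $v(T)=1$ satisfies $|x^*(Tx)|>1-\eta(\varepsilon,(x,x^* ))$, there is $S\in\mathcal{L}(X)$ with $v(S)=1$, $|x^*(Sx)|=1$ and $\|S-T\|<\varepsilon$. *)

theory Defs
  imports "HOL-Analysis.Analysis"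
begin

text \<open>A finite dimensional complex Banach space is modelled (up to linear isometry)
  as complex^'n (for an arbitrary finite index type 'n) equipped with an arbitrary
  norm N over the complex scalars. Every such space is complete.\<close>

definition is_cnorm :: "(complex^'n \<Rightarrow> real) \<Rightarrow> bool" where
  "is_cnorm N \<longleftrightarrow>
     (\<forall>x y. N (x + y) \<le> N x + N y) \<and>
     (\<forall>c x. N (c *s x) = cmod c * N x) \<and>
     (\<forall>x. N x = 0 \<longleftrightarrow> x = 0)"

text \<open>Complex-linear functionals on complex^'n (all are bounded, since the space is
  finite dimensional).\<close>
definition clin_fun :: "(complex^'n \<Rightarrow> complex) \<Rightarrow> bool" where
  "clin_fun f \<longleftrightarrow> (\<forall>x y. f (x + y) = f x + f y) \<and> (\<forall>c x. f (c *s x) = c * f x)"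

text \<open>Complex-linear operators on complex^'n (all are bounded).\<close>
definition clin_op :: "(complex^'n \<Rightarrow> complex^'n) \<Rightarrow> bool" where
  "clin_op T \<longleftrightarrow> (\<forall>x y. T (x + y) = T x + T y) \<and> (\<forall>c x. T (c *s x) = c *s T x)"

text \<open>Dual norm of a functional and operator norm of an operator.\<close>
definition dual_norm :: "(complex^'n \<Rightarrow> real) \<Rightarrow> (complex^'n \<Rightarrow> complex) \<Rightarrow> real" where
  "dual_norm N f = Sup {cmod (f x) | x. N x \<le> 1}"

definition op_norm :: "(complex^'n \<Rightarrow> real) \<Rightarrow> (complex^'n \<Rightarrow> complex^'n) \<Rightarrow> real" where
  "op_norm N T = Sup {N (T x) | x. N x \<le> 1}"

text \<open>The set Pi(X) of states.\<close>
definition states :: "(complex^'n \<Rightarrow> real) \<Rightarrow> ((complex^'n) \<times> (complex^'n \<Rightarrow> complex)) set" where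
  "states N = {(x, f). N x = 1 \<and> clin_fun f \<and> dual_norm N f = 1 \<and> f x = 1}"

text \<open>Numerical radius v(T).\<close>
definition num_radius :: "(complex^'n \<Rightarrow> real) \<Rightarrow> (complex^'n \<Rightarrow> complex^'n) \<Rightarrow> real" where
  "num_radius N T = Sup {cmod (f (T x)) | x f. (x, f) \<in> states N}"

text \<open>The L_{p,p}-nu property.\<close>
definition Lpp_nu :: "(complex^'n \<Rightarrow> real) \<Rightarrow> bool" where
  "Lpp_nu N \<longleftrightarrow>
    (\<forall>\<epsilon>>0. \<forall>(x, f) \<in> states N. \<exists>\<eta>>0. \<forall>T. clin_op T \<and> num_radius N T = 1 \<and>
        cmod (f (T x)) > 1 - \<eta> \<longrightarrow>
        (\<exists>S. clin_op S \<and> num_radius N S = 1 \<and> cmod (f (S x)) = 1 \<and>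
             op_norm N (\<lambda>y. S y - T y) < \<epsilon>))"

end

theory Submission
  imports Defs "HOL-Computational_Algebra.Fundamental_Theorem_Algebra"
begin
text \<open>
  The numerical radius v is a seminorm on operators, and on a complex space it is a norm:
  if v(T) = 0, every x is Birkhoff--James orthogonal to T x. Factoring a polynomial q with
  q(0) = 1 into linear factors 1 - z/r, orthogonality gives N(q(T) x) \<ge> N x; applied to an
  annihilating polynomial of x this makes T locally nilpotent, and orthogonality also rules
  out T y \<noteq> 0 = T(T y). Hence in finite dimension v is equivalent to the Euclidean norm on
  matrices and its unit sphere is compact. For a fixed state (x, f), the continuous function
  T \<mapsto> |f(T x)| is bounded by 1 on that sphere, and compactness of the part of the sphere at
  distance \<ge> \<delta> from the maximisers yields a uniform \<eta>.
\<close>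

lemma homogeneous_bounded_below_by_norm:
  fixes h :: "'a::euclidean_space \<Rightarrow> real"
  assumes cont: "continuous_on UNIV h"
    and hom: "\<And>r x. 0 \<le> r \<Longrightarrow> h (r *\<^sub>R x) = r * h x"
    and pos: "\<And>x. x \<noteq> 0 \<Longrightarrow> 0 < h x"
  shows "\<exists>c>0. \<forall>x. c * norm x \<le> h x"
proof -
  obtain e :: 'a where "norm e = 1" using vector_choose_size[of 1] by auto
  then have "sphere (0::'a) 1 \<noteq> {}" by auto
  then obtain x0 where x0: "x0 \<in> sphere 0 1"
    and min: "\<And>y. y \<in> sphere 0 1 \<Longrightarrow> h x0 \<le> h y"
    using continuous_attains_inf[OF compact_sphere _ continuous_on_subset[OF cont]] by blast
  show ?thesis
  proof (intro exI[of _ "h x0"] conjI allI)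
    show "0 < h x0" using x0 by (intro pos) auto
    fix x :: 'a
    show "h x0 * norm x \<le> h x"
    proof (cases "x = 0")
      case True
      then show ?thesis using hom[of 0 x] by simp
    next
      case False
      have "h x0 \<le> h ((1 / norm x) *\<^sub>R x)" using False by (intro min) simp
      also have "\<dots> = h x / norm x" using hom[of "1 / norm x" x] by simp
      finally show ?thesis using False by (simp add: field_simps)
    qed
  qed
qed

lemma near_maximum_imp_near_maximiser:
  fixes g :: "'a::metric_space \<Rightarrow> real"
  assumes S: "compact S" and g: "continuous_on S g"
    and le1: "\<And>x. x \<in> S \<Longrightarrow> g x \<le> 1" and "0 < \<delta>"
  shows "\<exists>\<eta>>0. \<forall>x\<in>S. 1 - \<eta> < g x \<longrightarrow> (\<exists>y\<in>S. g y = 1 \<and> dist y x < \<delta>)"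
proof -
  define far where "far = {x\<in>S. \<forall>y\<in>S. g y = 1 \<longrightarrow> \<delta> \<le> dist y x}"
  have "far = S \<inter> (\<Inter>y\<in>{y\<in>S. g y = 1}. - ball y \<delta>)"
    unfolding far_def by (auto simp: not_less)
  then have "compact far"
    using S by (auto intro!: compact_Int_closed closed_INT)
  show ?thesis
  proof (cases "far = {}")
    case True
    then show ?thesis unfolding far_def by (intro exI[of _ 1]) force
  next
    case False
    then obtain x0 where x0: "x0 \<in> far" and max: "\<And>x. x \<in> far \<Longrightarrow> g x \<le> g x0"
      using continuous_attains_sup[OF \<open>compact far\<close> _ continuous_on_subset[OF g]]
      unfolding far_def by blast
    have "g x0 \<noteq> 1"
      using x0 \<open>0 < \<delta>\<close> unfolding far_def by force
    moreover have "g x0 \<le> 1" using x0 le1 unfolding far_def by blast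
    ultimately show ?thesis
      using max unfolding far_def by (intro exI[of _ "1 - g x0"]) force
  qed
qed

lemma Re_eq_1_imp_eq_1:
  assumes "Re z = 1" "cmod z \<le> 1"
  shows "z = 1"
proof -
  have "(cmod z)\<^sup>2 \<le> 1" using assms(2) by (simp add: power_le_one)
  then have "Im z = 0" using assms(1) by (simp add: cmod_power2)
  then show ?thesis using assms(1) by (simp add: complex_eq_iff)
qed

lemma of_real_smult_vec: "complex_of_real r *s (x::complex^'n) = r *\<^sub>R x"
  by (simp add: vec_eq_iff scaleR_conv_of_real[symmetric])

lemma clin_fun_scaleR: "clin_fun f \<Longrightarrow> f (r *\<^sub>R x) = of_real r * f x"
  unfolding clin_fun_def by (metis of_real_smult_vec)

lemma clin_fun_bounded_linear:
  assumes f: "clin_fun f"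
  shows "bounded_linear f"
  unfolding linear_conv_bounded_linear[symmetric]
proof (rule linearI)
  show "f (x + y) = f x + f y" for x y using f by (simp add: clin_fun_def)
  show "f (r *\<^sub>R x) = r *\<^sub>R f x" for r x
    by (simp add: clin_fun_scaleR[OF f]) (simp add: scaleR_conv_of_real)
qed

lemma clin_op_0: "clin_op T \<Longrightarrow> T 0 = 0"
  unfolding clin_op_def by (metis add_cancel_right_right add_0)

lemma clin_op_iff_linear: "clin_op T \<longleftrightarrow> Vector_Spaces.linear (*s) (*s) T"
  by (auto simp: clin_op_def Vector_Spaces.linear_iff vec.vector_space_axioms)

lemma clin_op_matrix_vector_mult: "clin_op ((*v) A)"
  unfolding clin_op_iff_linear by (rule matrix_vector_mul_linear_gen)

lemma clin_op_matrix_works: "clin_op T \<Longrightarrow> (*v) (matrix T) = T"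
  unfolding clin_op_iff_linear by (auto simp: matrix_works)

lemma scaleR_matrix_vector_assoc_complex:
  fixes A :: "complex^'m^'n"
  shows "(r *\<^sub>R A) *v x = r *\<^sub>R (A *v x)"
  by (simp add: matrix_vector_mult_def vec_eq_iff scaleR_sum_right)

lemma bilinear_matrix_vector_mult: "bilinear ((*v) :: complex^'m^'n \<Rightarrow> complex^'m \<Rightarrow> complex^'n)"
  unfolding bilinear_def
  by (auto intro!: linearI simp: scaleR_matrix_vector_assoc_complex algebra_simps
      matrix_vector_mult_add_rdistrib)

section \<open>Polynomials in an operator\<close>

definition poly_op ::
    "complex poly \<Rightarrow> (complex^'n \<Rightarrow> complex^'n) \<Rightarrow> complex^'n \<Rightarrow> complex^'n" where
  "poly_op p T = fold_coeffs (\<lambda>a g w. a *s w + g (T w)) p (\<lambda>w. 0)"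

lemma poly_op_0 [simp]: "poly_op 0 T w = 0"
  by (simp add: poly_op_def)

lemma poly_op_pCons [simp]: "poly_op (pCons a p) T w = a *s w + poly_op p T (T w)"
  by (cases "p = 0 \<and> a = 0") (auto simp: poly_op_def)

lemma poly_op_add: "poly_op (p + q) T w = poly_op p T w + poly_op q T w"
proof (induction p arbitrary: q w)
  case (pCons a p)
  then show ?case
    by (cases q) (simp add: vector_sadd_rdistrib algebra_simps)
qed simp

lemma poly_op_smult: "poly_op (smult c p) T w = c *s poly_op p T w"
  by (induction p arbitrary: w) (simp_all add: vector_add_ldistrib vector_smult_assoc)

lemma poly_op_diff: "poly_op (p - q) T w = poly_op p T w - poly_op q T w"
  using poly_op_add[of "p - q" q T w] by (simp add: eq_diff_eq)

lemma poly_op_monom: "poly_op (monom c k) T w = c *s (T ^^ k) w"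
  by (induction k arbitrary: w) (simp_all add: monom_0 monom_Suc funpow_swap1)

lemma poly_op_sum: "poly_op (sum p I) T w = (\<Sum>i\<in>I. poly_op (p i) T w)"
  by (induction I rule: infinite_finite_induct) (simp_all add: poly_op_add)

lemma poly_op_monom_mult: "poly_op ([:0, 1:] ^ m * p) T w = poly_op p T ((T ^^ m) w)"
  by (induction m arbitrary: w) (simp_all add: mult.assoc funpow_swap1)

lemma poly_op_commute:
  assumes "clin_op T"
  shows "poly_op p T (T w) = T (poly_op p T w)"
  using assms by (induction p arbitrary: w) (simp_all add: clin_op_def clin_op_0)

lemma poly_op_linear_factor:
  assumes "clin_op T"
  shows "poly_op ([:a, b:] * q) T w = a *s poly_op q T w + b *s T (poly_op q T w)"
proof -
  have "[:a, b:] * q = smult a q + pCons 0 (smult b q)" by simp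
  then show ?thesis
    using assms by (simp add: poly_op_add poly_op_smult poly_op_commute[OF assms] clin_op_def)
qed

lemma poly_op_annihilator:
  fixes T :: "complex^'n \<Rightarrow> complex^'n"
  shows "\<exists>p. p \<noteq> 0 \<and> poly_op p T w = 0"
proof -
  \<comment> \<open>w, T w, ..., T^n w are n + 1 vectors in an n-dimensional space\<close>
  define V where "V k = (T ^^ k) w" for k
  define I where "I = {0..CARD('n)}"
  show ?thesis
  proof (cases "inj_on V I")
    case False
    then obtain i j where "i \<noteq> j" "V i = V j" unfolding inj_on_def by blast
    moreover have "monom (1::complex) i \<noteq> monom 1 j"
      using \<open>i \<noteq> j\<close> by (auto dest: arg_cong[where f = "\<lambda>p. coeff p i"])
    ultimately show ?thesis
      by (intro exI[of _ "monom 1 i - monom 1 j"]) (auto simp: poly_op_diff poly_op_monom V_def)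
  next
    case True
    have "vec.dependent (V ` I)"
    proof (rule ccontr)
      assume "vec.independent (V ` I)"
      then have "card (V ` I) \<le> vec.dim (V ` I)" using vec.independent_bound_general by blast
      also have "\<dots> \<le> CARD('n)" by (rule dim_subset_UNIV_cart_gen)
      finally show False using True unfolding I_def by (simp add: card_image)
    qed
    then obtain t u v where t: "t \<subseteq> V ` I" "(\<Sum>v\<in>t. u v *s v) = 0" and v: "v \<in> t" "u v \<noteq> 0"
      unfolding vec.dependent_explicit by blast
    define J where "J = I \<inter> V -` t"
    define p where "p = (\<Sum>k\<in>J. monom (u (V k)) k)"
    have "V ` J = t" using t(1) unfolding J_def by blast
    have "inj_on V J" using True unfolding J_def by (rule inj_on_subset) blast
    have "poly_op p T w = (\<Sum>k\<in>J. u (V k) *s V k)"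
      unfolding p_def poly_op_sum poly_op_monom V_def ..
    also have "\<dots> = (\<Sum>v\<in>t. u v *s v)"
      using sum.reindex[OF \<open>inj_on V J\<close>, of "\<lambda>v. u v *s v"] \<open>V ` J = t\<close> by simp
    finally have "poly_op p T w = 0" using t(2) by simp
    obtain k0 where k0: "k0 \<in> J" "v = V k0" using \<open>V ` J = t\<close> v(1) by blast
    have "coeff p k0 = (\<Sum>k\<in>J. if k = k0 then u (V k) else 0)"
      unfolding p_def coeff_sum coeff_monom ..
    also have "\<dots> = u v" using k0 unfolding J_def I_def by simp
    finally show ?thesis using \<open>poly_op p T w = 0\<close> v(2) by (intro exI[of _ p]) auto
  qed
qed

definition birkhoff_james_orthogonal ::
    "(complex^'n \<Rightarrow> real) \<Rightarrow> complex^'n \<Rightarrow> complex^'n \<Rightarrow> bool" where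
  "birkhoff_james_orthogonal N x y \<longleftrightarrow> (\<forall>z. N x \<le> N (x + z *s y))"

section \<open>Norms on complex^'n\<close>

locale complex_norm =
  fixes N :: "complex^'n \<Rightarrow> real"
  assumes is_cnorm: "is_cnorm N"
begin

lemma N_triangle: "N (x + y) \<le> N x + N y"
  and N_scale: "N (c *s x) = cmod c * N x"
  and N_eq_0_iff: "N x = 0 \<longleftrightarrow> x = 0"
  using is_cnorm unfolding is_cnorm_def by blast+

lemma N_0 [simp]: "N 0 = 0"
  using N_eq_0_iff by simp

lemma N_minus: "N (- x) = N x"
  by (metis N_scale vector_sneg_minus1 norm_minus_cancel norm_one mult_1)

lemma N_nonneg: "0 \<le> N x"
  using N_triangle[of x "- x"] N_minus[of x] by simp

lemma N_pos: "x \<noteq> 0 \<Longrightarrow> 0 < N x"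
  using N_nonneg[of x] N_eq_0_iff[of x] by linarith

lemma N_scaleR: "N (r *\<^sub>R x) = \<bar>r\<bar> * N x"
  using N_scale[of "of_real r" x] by (simp add: of_real_smult_vec)

lemma N_diff_abs_le: "\<bar>N x - N y\<bar> \<le> N (x - y)"
  using N_triangle[of "x - y" y] N_triangle[of "y - x" x] N_minus[of "x - y"] by simp

lemma N_le_norm: "N x \<le> (\<Sum>i\<in>UNIV. N (axis i 1)) * norm x"
proof -
  have "N x = N (\<Sum>i\<in>UNIV. x $ i *s axis i 1)" by (simp add: basis_expansion)
  also have "\<dots> \<le> (\<Sum>i\<in>UNIV. N (x $ i *s axis i 1))"
  proof (induction rule: infinite_finite_induct)
    case (insert i I)
    then show ?case using N_triangle[of "x $ i *s axis i 1" "\<Sum>i\<in>I. x $ i *s axis i 1"] by simp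
  qed simp_all
  also have "\<dots> \<le> (\<Sum>i\<in>UNIV. norm x * N (axis i 1))"
    by (intro sum_mono) (simp add: N_scale N_nonneg mult_right_mono Finite_Cartesian_Product.norm_nth_le)
  finally show ?thesis by (simp add: sum_distrib_left mult.commute)
qed

lemma continuous_on_N: "continuous_on S N"
proof (rule lipschitz_on_continuous_on)
  show "(\<Sum>i\<in>UNIV. N (axis i 1))-lipschitz_on S N"
  proof (rule lipschitz_onI)
    show "dist (N x) (N y) \<le> (\<Sum>i\<in>UNIV. N (axis i 1)) * dist x y" for x y
      using N_diff_abs_le[of x y] N_le_norm[of "x - y"] by (simp add: dist_norm dist_real_def)
  qed (simp add: sum_nonneg N_nonneg)
qed

lemma N_bounded_below: "\<exists>c>0. \<forall>x. c * norm x \<le> N x"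
  by (rule homogeneous_bounded_below_by_norm) (auto simp: continuous_on_N N_scaleR N_pos)

lemma N_matrix_vector_mult_le: "\<exists>K\<ge>0. \<forall>A x. N (A *v x) \<le> K * norm A * N x"
proof -
  define B where "B = (\<Sum>i\<in>UNIV. N (axis i 1))"
  obtain C where C: "0 < C" "\<And>(A :: complex^'n^'n) x. norm (A *v x) \<le> C * norm A * norm x"
    using bilinear_bounded_pos[OF bilinear_matrix_vector_mult] by blast
  obtain c where c: "0 < c" "\<And>x. c * norm x \<le> N x" using N_bounded_below by blast
  have "0 \<le> B" unfolding B_def by (simp add: sum_nonneg N_nonneg)
  have "N (A *v x) \<le> (B * C / c) * norm A * N x" for A :: "complex^'n^'n" and x
  proof -
    have "N (A *v x) \<le> B * (C * norm A * norm x)"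
      using N_le_norm[of "A *v x"] C(2)[of A x] \<open>0 \<le> B\<close> unfolding B_def
      by (meson mult_left_mono order_trans)
    also have "\<dots> \<le> B * (C * norm A * (N x / c))"
      using c C(1) \<open>0 \<le> B\<close> by (intro mult_left_mono) (auto simp: field_simps)
    finally show ?thesis by (simp add: field_simps)
  qed
  then show ?thesis using \<open>0 \<le> B\<close> C(1) c(1) by (intro exI[of _ "B * C / c"]) auto
qed

subsection \<open>Supporting functionals and states\<close>

lemma cmod_le_if_Re_le:
  assumes f: "clin_fun f" and Re_le: "\<And>w. Re (f w) \<le> N w"
  shows "cmod (f w) \<le> N w"
proof (cases "f w = 0")
  case True
  then show ?thesis by (simp add: N_nonneg)
next
  case False
  define u where "u = cnj (f w) / cmod (f w)"
  have "f (u *s w) = u * f w" using f unfolding clin_fun_def by blast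
  also have "\<dots> = cmod (f w)"
    using False unfolding u_def by (simp add: field_simps complex_norm_square[symmetric] power2_eq_square)
  finally have "cmod (f w) \<le> N (u *s w)" using Re_le[of "u *s w"] by simp
  also have "\<dots> = N w" using False by (simp add: N_scale u_def norm_divide)
  finally show ?thesis .
qed

lemma convex_N_less: "convex {w. N w < r}"
  unfolding convex_def
proof (intro allI impI ballI, clarsimp)
  fix x z :: "complex^'n" and u v :: real
  assume "N x < r" "N z < r" "0 \<le> u" "0 \<le> v" "u + v = 1"
  then have "u * N x + v * N z < r" by (rule convex_bound_lt)
  then show "N (u *\<^sub>R x + v *\<^sub>R z) < r"
    using N_triangle[of "u *\<^sub>R x" "v *\<^sub>R z"] \<open>0 \<le> u\<close> \<open>0 \<le> v\<close> by (simp add: N_scaleR)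
qed

lemma real_supporting_functional:
  assumes y: "N y = 1"
  shows "\<exists>a. a \<bullet> y = 1 \<and> (\<forall>w. a \<bullet> w \<le> N w)"
proof -
  have "(0::complex^'n) \<in> {w. N w < 1}" by simp
  then have "{w. N w < 1} \<noteq> {}" by blast
  moreover have "{w. N w < 1} \<inter> {y} = {}" using y by simp
  ultimately obtain a b where "a \<noteq> 0"
    and "\<forall>w\<in>{w. N w < 1}. a \<bullet> w \<le> b" "\<forall>w\<in>{y}. a \<bullet> w \<ge> b"
    using separating_hyperplane_sets[OF convex_N_less convex_singleton] by blast
  then have below: "\<And>w. N w < 1 \<Longrightarrow> a \<bullet> w \<le> b" and "b \<le> a \<bullet> y" by auto
  have bound: "a \<bullet> w \<le> s * (a \<bullet> y)" if "N w < s" for w s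
  proof -
    have "0 < s" using that N_nonneg[of w] by linarith
    then have "N ((1 / s) *\<^sub>R w) < 1" using that by (simp add: N_scaleR)
    then have "(1 / s) * (a \<bullet> w) \<le> a \<bullet> y"
      using below[of "(1 / s) *\<^sub>R w"] \<open>b \<le> a \<bullet> y\<close> unfolding inner_scaleR_right by linarith
    then show ?thesis using \<open>0 < s\<close> by (simp add: field_simps)
  qed
  have "0 < a \<bullet> y"
  proof (rule ccontr)
    assume "\<not> 0 < a \<bullet> y"
    then have "(N a + 1) * (a \<bullet> y) \<le> 0" using N_nonneg[of a] by (simp add: mult_nonneg_nonpos)
    then have "a \<bullet> a \<le> 0" using bound[of a "N a + 1"] by linarith
    then show False using \<open>a \<noteq> 0\<close> inner_gt_zero_iff[of a] by linarith
  qed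
  have "(1 / (a \<bullet> y)) *\<^sub>R a \<bullet> w \<le> N w" for w
  proof (rule field_le_epsilon)
    fix e :: real assume "0 < e"
    then have "a \<bullet> w \<le> (N w + e) * (a \<bullet> y)" by (intro bound) linarith
    then show "(1 / (a \<bullet> y)) *\<^sub>R a \<bullet> w \<le> N w + e"
      using \<open>0 < a \<bullet> y\<close> by (simp add: field_simps)
  qed
  then show ?thesis using \<open>0 < a \<bullet> y\<close> by (intro exI[of _ "(1 / (a \<bullet> y)) *\<^sub>R a"]) simp
qed

lemma dual_norm_eq_1:
  assumes "\<And>w. cmod (f w) \<le> N w" "N y = 1" "f y = 1"
  shows "dual_norm N f = 1"
  unfolding dual_norm_def
proof (rule cSup_eq_maximum)
  show "1 \<in> {cmod (f x) |x. N x \<le> 1}" using assms(2,3) by (intro CollectI exI[of _ y]) simp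
  fix z assume "z \<in> {cmod (f x) |x. N x \<le> 1}"
  then obtain x where "z = cmod (f x)" "N x \<le> 1" by blast
  then show "z \<le> 1" using assms(1)[of x] by simp
qed

lemma exists_state:
  assumes y: "N y = 1"
  shows "\<exists>f. (y, f) \<in> states N"
proof -
  obtain a where a: "a \<bullet> y = 1" "\<And>w. a \<bullet> w \<le> N w"
    using real_supporting_functional[OF y] by blast
  define f where "f w = (\<Sum>i\<in>UNIV. cnj (a $ i) * w $ i)" for w
  have Re_f: "Re (f w) = a \<bullet> w" for w
    by (simp add: f_def Re_sum inner_vec_def inner_complex_def)
  have f: "clin_fun f"
    unfolding clin_fun_def f_def by (auto simp: sum.distrib distrib_left sum_distrib_left algebra_simps)
  have le: "cmod (f w) \<le> N w" for w
    by (rule cmod_le_if_Re_le[OF f]) (simp add: Re_f a(2))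
  have "f y = 1" using le[of y] by (intro Re_eq_1_imp_eq_1) (simp_all add: Re_f a(1) y)
  then show ?thesis
    using f le y dual_norm_eq_1[of f y] unfolding states_def by auto
qed

lemma states_nonempty: "states N \<noteq> {}"
proof -
  obtain e :: "complex^'n" where "norm e = 1" using vector_choose_size[of 1] by auto
  then have "0 < N e" by (intro N_pos) auto
  then have "N ((1 / N e) *\<^sub>R e) = 1" by (simp add: N_scaleR)
  then show ?thesis using exists_state by blast
qed

lemma bdd_above_functional_on_ball:
  assumes f: "clin_fun f"
  shows "bdd_above {cmod (f w) |w. N w \<le> 1}"
proof -
  obtain K where K: "\<And>w. cmod (f w) \<le> norm w * K"
    using bounded_linear.bounded[OF clin_fun_bounded_linear[OF f]] by blast
  obtain c where c: "0 < c" "\<And>w. c * norm w \<le> N w" using N_bounded_below by blast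
  show ?thesis
  proof (rule bdd_aboveI[of _ "\<bar>K\<bar> / c"], clarify)
    fix w assume "N w \<le> 1"
    then have "norm w \<le> 1 / c" using c(1) c(2)[of w] by (simp add: field_simps)
    have "cmod (f w) \<le> norm w * \<bar>K\<bar>"
      using K[of w] mult_left_mono[OF abs_ge_self[of K] norm_ge_zero[of w]] by linarith
    also have "\<dots> \<le> (1 / c) * \<bar>K\<bar>"
      using mult_right_mono[OF \<open>norm w \<le> 1 / c\<close>, of "\<bar>K\<bar>"] by simp
    finally show "cmod (f w) \<le> \<bar>K\<bar> / c" by simp
  qed
qed

lemma state_functional_le:
  assumes "(x, f) \<in> states N"
  shows "cmod (f w) \<le> N w"
proof -
  have f: "clin_fun f" and "dual_norm N f = 1" using assms unfolding states_def by auto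
  have le1: "cmod (f w) \<le> 1" if "N w \<le> 1" for w
  proof -
    have "cmod (f w) \<in> {cmod (f w) |w. N w \<le> 1}" using that by blast
    then show ?thesis
      using cSup_upper[OF _ bdd_above_functional_on_ball[OF f]] \<open>dual_norm N f = 1\<close>
      unfolding dual_norm_def by simp
  qed
  show ?thesis
  proof (cases "w = 0")
    case True
    then show ?thesis using clin_fun_scaleR[OF f, of 0 w] by simp
  next
    case False
    then have "0 < N w" by (rule N_pos)
    then have "cmod (f ((1 / N w) *\<^sub>R w)) \<le> 1" by (intro le1) (simp add: N_scaleR)
    moreover have "cmod (f ((1 / N w) *\<^sub>R w)) = cmod (f w) / N w"
      using \<open>0 < N w\<close> by (simp add: clin_fun_scaleR[OF f] norm_divide)
    ultimately show ?thesis using \<open>0 < N w\<close> by (simp add: pos_divide_le_eq)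
  qed
qed

subsection \<open>The numerical radius of a matrix\<close>

lemma num_radius_le:
  assumes "\<And>x f. (x, f) \<in> states N \<Longrightarrow> cmod (f (T x)) \<le> c"
  shows "num_radius N T \<le> c"
  unfolding num_radius_def using states_nonempty assms by (intro cSup_least) auto

lemma state_matrix_bound:
  obtains K where "0 \<le> K" "\<And>x f A. (x, f) \<in> states N \<Longrightarrow> cmod (f (A *v x)) \<le> K * norm A"
proof -
  obtain K where K: "0 \<le> K" "\<And>A x. N (A *v x) \<le> K * norm A * N x"
    using N_matrix_vector_mult_le by blast
  have "cmod (f (A *v x)) \<le> K * norm A" if "(x, f) \<in> states N" for x f A
    using state_functional_le[OF that, of "A *v x"] K(2)[of A x] that unfolding states_def by auto
  then show thesis using K(1) that by blast
qed

text \<open>Operators are parametrised by matrices, so that they carry the Euclidean topology.\<close>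
definition num_radius_mat :: "complex^'n^'n \<Rightarrow> real" where
  "num_radius_mat A = num_radius N ((*v) A)"

lemma state_le_num_radius_mat:
  assumes "(x, f) \<in> states N"
  shows "cmod (f (A *v x)) \<le> num_radius_mat A"
proof -
  obtain K where "\<And>x f. (x, f) \<in> states N \<Longrightarrow> cmod (f (A *v x)) \<le> K * norm A"
    using state_matrix_bound by metis
  then have "bdd_above {cmod (f (A *v x)) |x f. (x, f) \<in> states N}"
    by (intro bdd_aboveI[of _ "K * norm A"]) blast
  then show ?thesis unfolding num_radius_mat_def num_radius_def using assms by (intro cSup_upper) auto
qed

lemma num_radius_mat_nonneg: "0 \<le> num_radius_mat A"
proof -
  obtain x f where "(x, f) \<in> states N" using states_nonempty by auto
  then show ?thesis using state_le_num_radius_mat norm_ge_zero order_trans by metis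
qed

lemma num_radius_mat_le_norm: "\<exists>K. \<forall>A. num_radius_mat A \<le> K * norm A"
proof -
  obtain K where "\<And>x f A. (x, f) \<in> states N \<Longrightarrow> cmod (f (A *v x)) \<le> K * norm A"
    using state_matrix_bound by metis
  then show ?thesis unfolding num_radius_mat_def by (blast intro: num_radius_le)
qed

lemma num_radius_mat_add_le: "num_radius_mat (A + B) \<le> num_radius_mat A + num_radius_mat B"
  unfolding num_radius_mat_def[of "A + B"]
proof (rule num_radius_le)
  fix x f assume xf: "(x, f) \<in> states N"
  then have "f ((A + B) *v x) = f (A *v x) + f (B *v x)"
    unfolding states_def clin_fun_def by (simp add: matrix_vector_mult_add_rdistrib)
  then have "cmod (f ((A + B) *v x)) \<le> cmod (f (A *v x)) + cmod (f (B *v x))"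
    by (simp add: norm_triangle_ineq)
  also have "\<dots> \<le> num_radius_mat A + num_radius_mat B"
    by (intro add_mono state_le_num_radius_mat[OF xf])
  finally show "cmod (f ((A + B) *v x)) \<le> num_radius_mat A + num_radius_mat B" .
qed

lemma continuous_on_num_radius_mat: "continuous_on S num_radius_mat"
proof -
  obtain K where K: "\<And>A. num_radius_mat A \<le> K * norm A" using num_radius_mat_le_norm by blast
  have "num_radius_mat A \<le> num_radius_mat B + K * dist A B" for A B
    using num_radius_mat_add_le[of B "A - B"] K[of "A - B"] by (simp add: dist_norm)
  then have "dist (num_radius_mat A) (num_radius_mat B) \<le> \<bar>K\<bar> * dist A B" for A B
    by (smt (verit, best) dist_commute dist_real_def mult_right_mono zero_le_dist)
  then show ?thesis by (intro lipschitz_on_continuous_on lipschitz_onI) auto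
qed

lemma num_radius_mat_scaleR_le:
  assumes "0 \<le> r"
  shows "num_radius_mat (r *\<^sub>R A) \<le> r * num_radius_mat A"
  unfolding num_radius_mat_def[of "r *\<^sub>R A"]
proof (rule num_radius_le)
  fix x f assume xf: "(x, f) \<in> states N"
  then have "cmod (f ((r *\<^sub>R A) *v x)) = r * cmod (f (A *v x))"
    using assms unfolding states_def
    by (auto simp: scaleR_matrix_vector_assoc_complex clin_fun_scaleR norm_mult)
  then show "cmod (f ((r *\<^sub>R A) *v x)) \<le> r * num_radius_mat A"
    using state_le_num_radius_mat[OF xf, of A] assms by (simp add: mult_left_mono)
qed

lemma num_radius_mat_scaleR:
  assumes "0 \<le> r"
  shows "num_radius_mat (r *\<^sub>R A) = r * num_radius_mat A"
proof (cases "r = 0")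
  case True
  then show ?thesis using num_radius_mat_scaleR_le[of 0 A] num_radius_mat_nonneg[of 0] by simp
next
  case False
  have "num_radius_mat A \<le> (1 / r) * num_radius_mat (r *\<^sub>R A)"
    using num_radius_mat_scaleR_le[of "1 / r" "r *\<^sub>R A"] assms False by simp
  then show ?thesis
    using num_radius_mat_scaleR_le[OF assms, of A] assms False by (simp add: field_simps)
qed

subsection \<open>Operators of numerical radius zero\<close>

context
  fixes T :: "complex^'n \<Rightarrow> complex^'n"
  assumes T: "clin_op T" and orth: "\<And>w. birkhoff_james_orthogonal N w (T w)"
begin

lemma N_le_poly_op:
  assumes "poly q 0 = 1"
  shows "N w \<le> N (poly_op q T w)"
  using assms
proof (induction "degree q" arbitrary: q w rule: less_induct)
  case less
  show ?case
  proof (cases "degree q = 0")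
    case True
    then have "q = 1" using less.prems by (metis degree_0_id poly_0_coeff_0 one_pCons)
    then show ?thesis by (simp add: one_pCons)
  next
    case False
    then have "\<not> constant (poly q)" by (simp add: constant_degree)
    then obtain r where "poly q r = 0" using fundamental_theorem_of_algebra by blast
    then obtain q1 where q1: "q = [:-r, 1:] * q1" by (metis dvdE poly_eq_0_iff_dvd)
    have "r \<noteq> 0" using \<open>poly q r = 0\<close> less.prems by auto
    define q2 where "q2 = smult (- r) q1"
    have "[:1, -1 / r:] * q2 = smult (- r) [:1, -1 / r:] * q1"
      unfolding q2_def by (simp only: mult_smult_left mult_smult_right)
    then have q: "q = [:1, -1 / r:] * q2" using q1 \<open>r \<noteq> 0\<close> by simp
    have "q1 \<noteq> 0" using q1 less.prems by auto
    then have "degree q = degree q1 + 1"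
      using degree_mult_eq[of "[:-r, 1:]" q1] unfolding q1 by simp
    then have "degree q2 < degree q" using \<open>r \<noteq> 0\<close> unfolding q2_def by simp
    moreover have "poly q2 0 = 1" using less.prems q by simp
    ultimately have "N w \<le> N (poly_op q2 T w)" by (rule less.hyps)
    also have "\<dots> \<le> N (poly_op q2 T w + (- 1 / r) *s T (poly_op q2 T w))"
      using orth unfolding birkhoff_james_orthogonal_def by blast
    also have "poly_op q2 T w + (- 1 / r) *s T (poly_op q2 T w) = poly_op q T w"
      unfolding q poly_op_linear_factor[OF T] by simp
    finally show ?thesis .
  qed
qed

lemma locally_nilpotent: "\<exists>m. (T ^^ m) w = 0"
proof -
  obtain p where "p \<noteq> 0" "poly_op p T w = 0" using poly_op_annihilator by blast
  obtain m p1 where p: "p = [:0, 1:] ^ m * p1" and "poly p1 0 \<noteq> 0"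
  proof -
    obtain p1 where "p = [:- 0, 1:] ^ order 0 p * p1" "\<not> [:- 0, 1:] dvd p1"
      using order_decomp[OF \<open>p \<noteq> 0\<close>] by blast
    then show thesis using that poly_eq_0_iff_dvd[of p1 0] by (metis minus_zero)
  qed
  have "poly_op p1 T ((T ^^ m) w) = 0"
    using \<open>poly_op p T w = 0\<close> unfolding p poly_op_monom_mult .
  then have "poly_op (smult (1 / poly p1 0) p1) T ((T ^^ m) w) = 0" by (simp add: poly_op_smult)
  moreover have "poly (smult (1 / poly p1 0) p1) 0 = 1" using \<open>poly p1 0 \<noteq> 0\<close> by simp
  ultimately have "N ((T ^^ m) w) \<le> 0" using N_le_poly_op[of _ "(T ^^ m) w"] by fastforce
  then show ?thesis using N_nonneg N_eq_0_iff order_antisym by blast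
qed

lemma square_zero_imp_zero:
  assumes "T (T y) = 0"
  shows "T y = 0"
proof (rule ccontr)
  assume "T y \<noteq> 0"
  \<comment> \<open>T (y + c T y) = T y, so orthogonality gives N (y + c T y) \<le> N y for every c\<close>
  define r where "r = (2 * N y + 1) / N (T y)"
  define c where "c = complex_of_real r"
  have "N (y + c *s T y) \<le> N ((y + c *s T y) + (- c) *s T (y + c *s T y))"
    using orth unfolding birkhoff_james_orthogonal_def by blast
  also have "(y + c *s T y) + (- c) *s T (y + c *s T y) = y"
    using T assms unfolding clin_op_def by (simp add: vec_eq_iff algebra_simps)
  finally have "N (y + c *s T y) \<le> N y" .
  moreover have "N (c *s T y) = 2 * N y + 1"
  proof -
    have "0 < r" using N_pos[OF \<open>T y \<noteq> 0\<close>] N_nonneg[of y] unfolding r_def by simp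
    then have "N (c *s T y) = r * N (T y)" by (simp add: c_def N_scale)
    also have "\<dots> = 2 * N y + 1" using N_pos[OF \<open>T y \<noteq> 0\<close>] by (simp add: r_def)
    finally show ?thesis .
  qed
  moreover have "N (c *s T y) \<le> N (y + c *s T y) + N y"
    using N_triangle[of "y + c *s T y" "- y"] N_minus[of y] by simp
  ultimately show False by linarith
qed

lemma op_eq_0: "T w = 0"
proof -
  have "(T ^^ m) w = 0 \<Longrightarrow> T w = 0" for m w
  proof (induction m arbitrary: w)
    case 0
    then show ?case using clin_op_0[OF T] by simp
  next
    case (Suc m)
    then have "T (T w) = 0" by (simp add: funpow_swap1)
    then show ?case by (rule square_zero_imp_zero)
  qed
  then show ?thesis using locally_nilpotent by blast
qed

end

lemma birkhoff_james_orthogonal_if_num_radius_mat_0: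
  assumes "num_radius_mat A = 0"
  shows "birkhoff_james_orthogonal N w (A *v w)"
  unfolding birkhoff_james_orthogonal_def
proof
  fix z
  show "N w \<le> N (w + z *s (A *v w))"
  proof (cases "w = 0")
    case False
    define s where "s = complex_of_real (1 / N w)"
    have N_s: "N (s *s v) = N v / N w" for v
      using N_pos[OF False] by (simp add: N_scale s_def norm_divide)
    then have "N (s *s w) = 1" using N_pos[OF False] by simp
    then obtain f where f: "(s *s w, f) \<in> states N" using exists_state by blast
    then have "f (A *v (s *s w)) = 0" using state_le_num_radius_mat[OF f, of A] assms by simp
    moreover have "clin_fun f" "f (s *s w) = 1" using f unfolding states_def by auto
    moreover have "s *s (w + z *s (A *v w)) = s *s w + z *s (A *v (s *s w))"
      by (simp add: vec.scale vector_add_ldistrib vector_smult_assoc mult.commute)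
    ultimately have "f (s *s (w + z *s (A *v w))) = 1" by (simp add: clin_fun_def)
    then have "1 \<le> N (s *s (w + z *s (A *v w)))"
      using state_functional_le[OF f, of "s *s (w + z *s (A *v w))"] by simp
    also have "\<dots> = N (w + z *s (A *v w)) / N w" by (rule N_s)
    finally show ?thesis using N_pos[OF False] by (simp add: field_simps)
  qed (simp add: N_nonneg)
qed

lemma num_radius_mat_eq_0: "num_radius_mat A = 0 \<Longrightarrow> A = 0"
  using op_eq_0[OF clin_op_matrix_vector_mult birkhoff_james_orthogonal_if_num_radius_mat_0]
  by (simp add: matrix_eq)

lemma num_radius_mat_bounded_below: "\<exists>c>0. \<forall>A. c * norm A \<le> num_radius_mat A"
proof (rule homogeneous_bounded_below_by_norm)
  show "0 < num_radius_mat A" if "A \<noteq> 0" for A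
    using that num_radius_mat_eq_0[of A] num_radius_mat_nonneg[of A] by force
qed (simp_all add: continuous_on_num_radius_mat num_radius_mat_scaleR)

lemma op_norm_matrix_le: "\<exists>K\<ge>0. \<forall>A. op_norm N ((*v) A) \<le> K * norm A"
proof -
  obtain K where K: "0 \<le> K" "\<And>A x. N (A *v x) \<le> K * norm A * N x"
    using N_matrix_vector_mult_le by blast
  have "op_norm N ((*v) A) \<le> K * norm A" for A
    unfolding op_norm_def
  proof (rule cSup_least)
    have "N (A *v 0) \<in> {N (A *v x) |x. N x \<le> 1}" by (intro CollectI exI[of _ 0]) simp
    then show "{N (A *v x) |x. N x \<le> 1} \<noteq> {}" by blast
    fix z assume "z \<in> {N (A *v x) |x. N x \<le> 1}"
    then obtain x where "z = N (A *v x)" "N x \<le> 1" by blast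
    then show "z \<le> K * norm A"
      using K(2)[of A x] mult_left_mono[OF \<open>N x \<le> 1\<close>, of "K * norm A"] K(1) by simp
  qed
  then show ?thesis using K(1) by blast
qed

lemma compact_num_radius_mat_sphere: "compact {A. num_radius_mat A = 1}"
proof -
  obtain c where c: "0 < c" "\<And>A. c * norm A \<le> num_radius_mat A"
    using num_radius_mat_bounded_below by blast
  have "closed {A. num_radius_mat A = 1}"
    using continuous_on_num_radius_mat by (intro closed_Collect_eq) auto
  moreover have "norm A \<le> 1 / c" if "num_radius_mat A = 1" for A
    using c(1) c(2)[of A] that by (simp add: field_simps)
  then have "bounded {A. num_radius_mat A = 1}" unfolding bounded_iff by blast
  ultimately show ?thesis by (simp add: compact_eq_bounded_closed)
qed

lemma Lpp_nu_matrix_at_state: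
  assumes xf: "(x, f) \<in> states N" and "0 < \<epsilon>"
  obtains \<eta> where "0 < \<eta>"
    and "\<And>A. num_radius_mat A = 1 \<Longrightarrow> 1 - \<eta> < cmod (f (A *v x)) \<Longrightarrow>
      \<exists>B. num_radius_mat B = 1 \<and> cmod (f (B *v x)) = 1 \<and> op_norm N ((*v) (B - A)) < \<epsilon>"
proof -
  obtain K where K: "0 \<le> K" "\<And>A. op_norm N ((*v) A) \<le> K * norm A"
    using op_norm_matrix_le by blast
  have "clin_fun f" using xf unfolding states_def by blast
  have "bounded_bilinear ((*v) :: complex^'n^'n \<Rightarrow> complex^'n \<Rightarrow> complex^'n)"
    using bilinear_matrix_vector_mult by (simp add: bilinear_conv_bounded_bilinear)
  then have "bounded_linear (\<lambda>A. f (A *v x))"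
    by (intro bounded_linear_compose[OF clin_fun_bounded_linear[OF \<open>clin_fun f\<close>]]
        bounded_bilinear.bounded_linear_left)
  then have cont: "continuous_on {A. num_radius_mat A = 1} (\<lambda>A. cmod (f (A *v x)))"
    by (intro continuous_on_norm linear_continuous_on)
  have le1: "cmod (f (A *v x)) \<le> 1" if "A \<in> {A. num_radius_mat A = 1}" for A
    using state_le_num_radius_mat[OF xf, of A] that by simp
  have "0 < \<epsilon> / (K + 1)" using \<open>0 < \<epsilon>\<close> K(1) by simp
  from near_maximum_imp_near_maximiser[OF compact_num_radius_mat_sphere cont le1 this]
  obtain \<eta> where "0 < \<eta>"
    and \<eta>: "\<And>A. num_radius_mat A = 1 \<Longrightarrow> 1 - \<eta> < cmod (f (A *v x)) \<Longrightarrow>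
      \<exists>B. num_radius_mat B = 1 \<and> cmod (f (B *v x)) = 1 \<and> dist B A < \<epsilon> / (K + 1)"
    by auto
  have close: "op_norm N ((*v) (B - A)) < \<epsilon>" if "dist B A < \<epsilon> / (K + 1)" for A B
  proof -
    have "op_norm N ((*v) (B - A)) \<le> K * dist B A"
      using K(2)[of "B - A"] by (simp add: dist_norm)
    also have "\<dots> \<le> K * (\<epsilon> / (K + 1))"
      using mult_left_mono[OF less_imp_le[OF that] K(1)] .
    also have "\<dots> < \<epsilon>" using K(1) \<open>0 < \<epsilon>\<close> by (simp add: field_simps)
    finally show ?thesis .
  qed
  show thesis
  proof (rule that[OF \<open>0 < \<eta>\<close>])
    fix A assume "num_radius_mat A = 1" "1 - \<eta> < cmod (f (A *v x))"
    then show "\<exists>B. num_radius_mat B = 1 \<and> cmod (f (B *v x)) = 1 \<and>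
        op_norm N ((*v) (B - A)) < \<epsilon>"
      using \<eta> close by blast
  qed
qed

lemma Lpp_nu_at_state:
  assumes "(x, f) \<in> states N" "0 < \<epsilon>"
  shows "\<exists>\<eta>>0. \<forall>T. clin_op T \<and> num_radius N T = 1 \<and> 1 - \<eta> < cmod (f (T x)) \<longrightarrow>
    (\<exists>S. clin_op S \<and> num_radius N S = 1 \<and> cmod (f (S x)) = 1 \<and> op_norm N (\<lambda>y. S y - T y) < \<epsilon>)"
proof -
  obtain \<eta> where "0 < \<eta>"
    and \<eta>: "\<And>A. num_radius_mat A = 1 \<Longrightarrow> 1 - \<eta> < cmod (f (A *v x)) \<Longrightarrow>
      \<exists>B. num_radius_mat B = 1 \<and> cmod (f (B *v x)) = 1 \<and> op_norm N ((*v) (B - A)) < \<epsilon>"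
    using Lpp_nu_matrix_at_state[OF assms] by blast
  have "\<exists>S. clin_op S \<and> num_radius N S = 1 \<and> cmod (f (S x)) = 1 \<and> op_norm N (\<lambda>y. S y - T y) < \<epsilon>"
    if T: "clin_op T" "num_radius N T = 1" "1 - \<eta> < cmod (f (T x))" for T
  proof -
    note T_eq = clin_op_matrix_works[OF T(1)]
    obtain B where B: "num_radius_mat B = 1" "cmod (f (B *v x)) = 1"
      "op_norm N ((*v) (B - matrix T)) < \<epsilon>"
      using \<eta>[of "matrix T"] T(2,3) unfolding num_radius_mat_def T_eq by blast
    have "(\<lambda>y. B *v y - T y) = (*v) (B - matrix T)"
      by (subst T_eq[symmetric]) (simp add: fun_eq_iff matrix_vector_mult_diff_rdistrib)
    then show ?thesis
      using B clin_op_matrix_vector_mult unfolding num_radius_mat_def by (intro exI[of _ "(*v) B"]) auto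
  qed
  then show ?thesis using \<open>0 < \<eta>\<close> by blast
qed

lemma Lpp_nu: "Lpp_nu N"
  unfolding Lpp_nu_def using Lpp_nu_at_state by blast

end

theorem corollary3p4:
  fixes N :: "complex^'n \<Rightarrow> real"
  assumes "is_cnorm N"
  shows "Lpp_nu N"
  using assms by (rule complex_norm.Lpp_nu[OF complex_norm.intro])

end
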